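(* Let $F\colon \mathbb{R}^n\rightrightarrows \mathbb{R}^p$ be a nearly convex set-valued mapping. Then $$\mathrm{ri}(\mathrm{gph}\, F)=\big\{(\bar x,\bar y)\in \mathbb{R}^n\times\mathbb{R}^p \;\big|\; \bar x\in \mathrm{ri}(\mathrm{dom}\, F),\ \bar y\in \mathrm{ri}\, F(\bar x)\big\}.$$
   Context: A set $\Omega\subset\mathbb{R}^k$ is nearly convex if there exists a convex set $C\subset\mathbb{R}^k$ such that $C\subset\Omega\subset\overline{C}$, where $\overline{C}$ is the closure of $C$. For an arbitrary set $\Omega\subset\mathbb{R}^k$, the relative interior is $\mathrm{ri}\,\Omega=\{a\in\Omega \mid \text{there exists } \delta>0 \text{ with } B(a;\delta)\cap \mathrm{aff}\,\Omega\subset\Omega\}$, where $\mathrm{aff}\,\Omega$ is the affine hull and $B(a;\delta)$ the open ball. A set-valued mapping $F\colon\mathbb{R}^n\rightrightarrows\mathbb{R}^p$ assigns to each $x\in\mathbb{R}^n$ a (possibly empty) subset $F(x)\subset\mathbb{R}^p$; $\mathrm{dom}\,F=\{x\mid F(x)\neq\emptyset\}$ and $\mathrm{gph}\,F=\{(x,y)\in\mathbb{R}^n\times\mathbb{R}^p\mid y\in F(x)\}$. $F$ is nearly convex if $\mathrm{gph}\,F$ is a nearly convex set. *)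

theory Defs
  imports "HOL-Analysis.Analysis"
begin

definition nearly_convex :: "'a::euclidean_space set \<Rightarrow> bool" where
  "nearly_convex S \<longleftrightarrow> (\<exists>C. convex C \<and> C \<subseteq> S \<and> S \<subseteq> closure C)"

(* A set-valued mapping from 'a to 'b is a total function 'a => 'b set;
   points outside the domain are those mapped to the empty set. *)

definition sv_dom :: "('a \<Rightarrow> 'b set) \<Rightarrow> 'a set" where
  "sv_dom F = {x. F x \<noteq> {}}"

definition sv_gph :: "('a \<Rightarrow> 'b set) \<Rightarrow> ('a \<times> 'b) set" where
  "sv_gph F = {(x, y). y \<in> F x}"

definition sv_nearly_convex ::
    "('a::euclidean_space \<Rightarrow> 'b::euclidean_space set) \<Rightarrow> bool" where
  "sv_nearly_convex F \<longleftrightarrow> nearly_convex (sv_gph F)"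

end

theory Submission
  imports Defs
begin

text \<open>A set squeezed between a convex set and its closure has the relative interior of the convex
  set. The projection formula for convex sets therefore transfers to the graph of \<open>F\<close> once its fibres
  over the relative interior of the domain are squeezed in the same way; this holds because the
  segment from a relative interior point of a convex set to a point of its closure stays in the set,
  up to the endpoint.\<close>

text \<open>\<open>C\<close>, \<open>S\<close> and \<open>closure C\<close> share one affine hull,
  on which \<open>rel_interior\<close> is monotone; convexity makes the outer two relative interiors
  coincide.\<close>

lemma rel_interior_between_closure:
  fixes C S :: "'a::euclidean_space set"
  assumes "convex C" "C \<subseteq> S" "S \<subseteq> closure C"
  shows "rel_interior S = rel_interior C"
proof -
  have "affine hull C \<subseteq> affine hull S" "affine hull S \<subseteq> affine hull closure C"
    by (rule hull_mono, fact)+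
  then have hull: "affine hull S = affine hull C"
    by simp
  have "rel_interior C \<subseteq> rel_interior S"
    using assms(2) hull by (intro subset_rel_interior) auto
  moreover have "rel_interior S \<subseteq> rel_interior (closure C)"
    using assms(3) hull by (intro subset_rel_interior) auto
  ultimately show ?thesis
    using convex_rel_interior_closure[OF assms(1)] by simp
qed

text \<open>This can fail over a boundary point: add one point of the left edge to an open
  square.\<close>

lemma closure_fibre_rel_interior:
  fixes C :: "('a::euclidean_space \<times> 'b::euclidean_space) set"
  assumes C: "convex C" and x: "x \<in> rel_interior (fst ` C)"
  shows "closure C `` {x} \<subseteq> closure (C `` {x})"
proof
  fix y assume "y \<in> closure C `` {x}"
  then have y: "(x, y) \<in> closure C" by simp
  \<comment> \<open>For convex sets, projection commutes with relative interior, so \<open>x\<close>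
    lifts into \<open>rel_interior C\<close>.\<close>
  from x have "x \<in> fst ` rel_interior C"
    using rel_interior_convex_linear_image[OF linear_fst C] by simp
  then obtain z where z: "(x, z) \<in> rel_interior C" by auto
  have "open_segment z y \<subseteq> C `` {x}"
  proof
    fix w assume "w \<in> open_segment z y"
    then have "(x, w) \<in> open_segment (x, z) (x, y)"
      by (auto simp: in_segment scaleR_left_diff_distrib)
    then have "(x, w) \<in> rel_interior C"
      using rel_interior_closure_convex_segment[OF C z y] by blast
    then show "w \<in> C `` {x}"
      using rel_interior_subset by blast
  qed
  then have "closure (open_segment z y) \<subseteq> closure (C `` {x})"
    by (rule closure_mono)
  moreover have "z \<in> C `` {x}"
    using z rel_interior_subset by blast
  \<comment> \<open>If \<open>z = y\<close>, the open segment is empty but \<open>y\<close> already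
    lies in the fibre; otherwise its closure contains the endpoint \<open>y\<close>.\<close>
  ultimately show "y \<in> closure (C `` {x})"
    using closure_subset[of "C `` {x}"] ends_in_segment(2)[of y z] by (cases "z = y") auto
qed

theorem theorem3p6:
  fixes F :: "real ^ 'n \<Rightarrow> (real ^ 'p) set"
  assumes "sv_nearly_convex F"
  shows "rel_interior (sv_gph F)
       = {(x, y). x \<in> rel_interior (sv_dom F) \<and> y \<in> rel_interior (F x)}"
proof -
  obtain C where C: "convex C" "C \<subseteq> sv_gph F" "sv_gph F \<subseteq> closure C"
    using assms unfolding sv_nearly_convex_def nearly_convex_def by blast
  have dom: "sv_dom F = fst ` sv_gph F"
    by (force simp: sv_dom_def sv_gph_def)
  have "fst ` closure C \<subseteq> closure (fst ` C)"
    by (rule closure_linear_image_subset[OF linear_fst])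
  then have ri_dom: "rel_interior (sv_dom F) = rel_interior (fst ` C)"
    unfolding dom using C
    by (intro rel_interior_between_closure convex_linear_image linear_fst) auto
  have ri_fibre: "rel_interior (F x) = rel_interior (C `` {x})"
    if "x \<in> rel_interior (fst ` C)" for x
  proof (rule rel_interior_between_closure)
    show "convex (C `` {x})"
    proof (rule convexI)
      fix y z and u v :: real
      assume "y \<in> C `` {x}" "z \<in> C `` {x}" and u: "0 \<le> u" "0 \<le> v" "u + v = 1"
      then have "u *\<^sub>R (x, y) + v *\<^sub>R (x, z) \<in> C"
        by (intro convexD[OF C(1)]) auto
      then show "u *\<^sub>R y + v *\<^sub>R z \<in> C `` {x}"
        using u(3) by (simp flip: scaleR_left_distrib)
    qed
    show "C `` {x} \<subseteq> F x"
      using C(2) by (auto simp: sv_gph_def)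
    have "F x \<subseteq> closure C `` {x}"
      using C(3) by (auto simp: sv_gph_def)
    also have "\<dots> \<subseteq> closure (C `` {x})"
      by (rule closure_fibre_rel_interior[OF C(1) that])
    finally show "F x \<subseteq> closure (C `` {x})" .
  qed
  have "rel_interior (sv_gph F) = rel_interior C"
    by (rule rel_interior_between_closure[OF C])
  moreover have "(x, y) \<in> rel_interior C \<longleftrightarrow>
      x \<in> rel_interior (fst ` C) \<and> y \<in> rel_interior (C `` {x})" for x y
  proof -
    \<comment> \<open>These equalities match the fibre form of the projection formula.\<close>
    have "{x. C `` {x} \<noteq> {}} = fst ` C" by force
    moreover have "(\<lambda>x. C `` {x}) = (\<lambda>x. {y. (x, y) \<in> C})" by auto
    ultimately show ?thesis
      using rel_interior_projection[OF C(1), of "\<lambda>x. C `` {x}"] by simp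
  qed
  \<comment> \<open>\<open>ri_fibre\<close> holds only over the relative interior of the domain;
    \<open>conj_cong\<close> supplies that membership when rewriting the second conjunct.\<close>
  ultimately show ?thesis
    using ri_dom ri_fibre by (simp add: set_eq_iff split_paired_all cong: conj_cong)
qed

end
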